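(* There is an infinite family of connected planar graphs $G$ such that $\gamma_I^p(G) = n$, where $n$ is the number of vertices of $G$.
   Context: All graphs are finite, simple and undirected. For a graph $G=(V,E)$ and $v\in V$, $N(v)$ denotes the set of neighbours of $v$. A perfect Italian dominating function (PID-function) of $G$ is a function $f:V\to\{0,1,2\}$ such that for every vertex $v$ with $f(v)=0$ one has $\sum_{u\in N(v)} f(u)=2$. The weight of $f$ is $\sum_{v\in V} f(v)$. The perfect Italian domination number $\gamma_I^p(G)$ is the minimum weight of a PID-function of $G$. *)

theory Defs
  imports "HOL-Analysis.Analysis" "Graph_Theory.Graph_Theory"
begin

text \<open>A finite simple undirected graph is a \<open>pair_graph\<close>: a finite vertex set together with a
  symmetric, irreflexive arc relation, so each edge \<open>{u, v}\<close> is present as both \<open>(u, v)\<close>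
  and \<open>(v, u)\<close>.\<close>

definition neighbours :: "'a pair_pre_digraph \<Rightarrow> 'a \<Rightarrow> 'a set" where
  "neighbours G v = {u. (v, u) \<in> parcs G}"

definition PID_function :: "'a pair_pre_digraph \<Rightarrow> ('a \<Rightarrow> nat) \<Rightarrow> bool" where
  "PID_function G f \<longleftrightarrow>
     f \<in> pverts G \<rightarrow> {0, 1, 2} \<and>
     (\<forall>v\<in>pverts G. f v = 0 \<longrightarrow> (\<Sum>u\<in>neighbours G v. f u) = 2)"

definition weight :: "'a pair_pre_digraph \<Rightarrow> ('a \<Rightarrow> nat) \<Rightarrow> nat" where
  "weight G f = (\<Sum>v\<in>pverts G. f v)"

text \<open>The constant function 1 is always a PID-function, so the minimum is attained.\<close>

definition perfect_italian_domination_number :: "'a pair_pre_digraph \<Rightarrow> nat" where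
  "perfect_italian_domination_number G = (LEAST w. \<exists>f. PID_function G f \<and> weight G f = w)"

text \<open>A drawing without crossings: \<open>p\<close> places the vertices, and \<open>c\<close> maps each (unordered)
  edge to the point set of a simple curve joining its end points. Curves pass through no other
  vertices, and the curves of distinct edges meet only in common end points.\<close>

definition plane_drawing ::
    "'a pair_pre_digraph \<Rightarrow> ('a \<Rightarrow> real \<times> real) \<Rightarrow> ('a set \<Rightarrow> (real \<times> real) set) \<Rightarrow> bool" where
  "plane_drawing G p c \<longleftrightarrow>
     inj_on p (pverts G) \<and>
     (\<forall>(u, v)\<in>parcs G.
        (\<exists>g. Path_Connected.arc g \<and> pathstart g = p u \<and> pathfinish g = p v \<and>
             path_image g = c {u, v}) \<and>
        c {u, v} \<inter> p ` pverts G = {p u, p v}) \<and>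
     (\<forall>(u, v)\<in>parcs G. \<forall>(x, y)\<in>parcs G.
        {u, v} \<noteq> {x, y} \<longrightarrow> c {u, v} \<inter> c {x, y} \<subseteq> p ` ({u, v} \<inter> {x, y}))"

definition planar :: "'a pair_pre_digraph \<Rightarrow> bool" where
  "planar G \<longleftrightarrow> (\<exists>p c. plane_drawing G p c)"

end

theory Submission
  imports Defs
begin

text \<open>Take \<open>K\<^sub>5\<close> minus an edge, i.e. a triangle with two non-adjacent apexes \<open>b\<close> and \<open>c\<close>, and attach a
  leaf to each vertex of the triangle. The graphs are chains of such blocks, consecutive blocks
  being joined by an edge between triangle vertices. A PID-function never vanishes on a triangle
  vertex: its leaf would then have positive value, leaving at most 1 for its other neighbours, so
  \<open>b\<close> or \<open>c\<close> has value 0 and the triangle has total 2; then the other two triangle vertices already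
  contribute 2, a contradiction. So the triangle has total at least 3, which makes \<open>b\<close> and \<open>c\<close>
  nonzero, and each triangle vertex together with its leaf has total at least 2, since a leaf of
  value 0 forces value 2. Hence every block has weight at least 8, its number of vertices.\<close>

section \<open>The chain graphs; in each block 0, 1, 2 form the triangle, 3 and 4 are the apexes, 5,
  6, 7 the leaves\<close>

definition block_edges :: "(nat \<times> nat) set" where
  "block_edges = {(0,1), (0,2), (1,2), (0,3), (1,3), (2,3), (0,4), (1,4), (2,4),
                  (0,5), (1,6), (2,7), (1,8)}"

text \<open>Index 8 of a block is index 0 of the next block, so \<open>(1,8)\<close> links consecutive blocks.\<close>

definition chain_arcs :: "(nat \<times> nat) set" where
  "chain_arcs = {(u, v). \<exists>i. \<exists>(a, b)\<in>block_edges.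
     (u = 8 * i + a \<and> v = 8 * i + b) \<or> (u = 8 * i + b \<and> v = 8 * i + a)}"

text \<open>Blocks 0 to \<open>k\<close> of the infinite chain. The intersection also cuts the link
  leaving block \<open>k\<close>, whose far end \<open>8 * Suc k\<close> is not a vertex.\<close>

definition chain :: "nat \<Rightarrow> nat pair_pre_digraph" where
  "chain k = \<lparr>pverts = {..<8 * Suc k}, parcs = chain_arcs \<inter> ({..<8 * Suc k} \<times> {..<8 * Suc k})\<rparr>"

lemma pverts_chain [simp]: "pverts (chain k) = {..<8 * Suc k}"
  by (simp add: chain_def)

lemma parcs_chain [simp]:
  "parcs (chain k) = chain_arcs \<inter> ({..<8 * Suc k} \<times> {..<8 * Suc k})"
  by (simp add: chain_def)

lemma chain_arcs_commute: "(u, v) \<in> chain_arcs \<longleftrightarrow> (v, u) \<in> chain_arcs"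
  unfolding chain_arcs_def by auto

lemma chain_arcsI:
  assumes "(a, b) \<in> block_edges"
  shows "(8 * i + a, 8 * i + b) \<in> chain_arcs" "(8 * i + b, 8 * i + a) \<in> chain_arcs"
  using assms unfolding chain_arcs_def by blast+

lemma chain_arcsE:
  assumes "(u, v) \<in> chain_arcs"
  obtains i a b where "(a, b) \<in> block_edges" "{u, v} = {8 * i + a, 8 * i + b}"
  using assms unfolding chain_arcs_def by blast

lemma block_edges_less: "(a, b) \<in> block_edges \<Longrightarrow> a < b \<and> b \<le> 8 \<and> a < 8"
  unfolding block_edges_def by auto

lemma chain_arcs_irrefl: "(u, u) \<notin> chain_arcs"
  unfolding chain_arcs_def using block_edges_less by fastforce

lemma pair_graph_chain: "pair_graph (chain k)"
proof
  show "symmetric (with_proj (chain k))"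
    unfolding symmetric_def using chain_arcs_commute by (auto intro!: symI)
  show "fst e \<noteq> snd e" if "e \<in> parcs (chain k)" for e
    using that chain_arcs_irrefl by (cases e) auto
qed auto

section \<open>Connectedness\<close>

lemma connected_chain: "Digraph_Component.connected (with_proj (chain k))"
proof -
  interpret pair_graph "chain k" by (rule pair_graph_chain)
  let ?R = "reachable (with_proj (chain k))"
  have trans: "?R u w" if "?R u v" "?R v w" for u v w
    using reachable_trans that .
  \<comment> \<open>Only descending steps are used: each vertex reaches the first vertex of its
    block, and first vertices reach 0 block by block. Symmetry then joins any two vertices through
    0.\<close>
  have adj: "?R (8 * i + b) (8 * i + a)" if "(a, b) \<in> block_edges" "8 * i + b < 8 * Suc k" for i a b
    using that chain_arcsI(2)[OF that(1), of i] block_edges_less[OF that(1)]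
    by (intro reachable_adjI) auto
  have block: "?R (8 * i + a) (8 * i)" if "a < 8" "i \<le> k" for i a
  proof -
    have 0: "?R (8 * i + 0) (8 * i)"
      using \<open>i \<le> k\<close> by simp
    have 1: "?R (8 * i + c) (8 * i)" if "c \<in> {1,2,3,4,5}" for c
      using adj[of 0 c i] that \<open>i \<le> k\<close> by (auto simp: block_edges_def)
    have "?R (8 * i + 6) (8 * i + 1)" "?R (8 * i + 7) (8 * i + 2)"
      using adj[of 1 6 i] adj[of 2 7 i] \<open>i \<le> k\<close> by (simp_all add: block_edges_def)
    then have 2: "?R (8 * i + 6) (8 * i)" "?R (8 * i + 7) (8 * i)"
      using trans 1 by blast+
    have "a = 0 \<or> a \<in> {1,2,3,4,5} \<or> a = 6 \<or> a = 7"
      using \<open>a < 8\<close> by auto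
    then show ?thesis
      using 0 1 2 by metis
  qed
  have base: "?R (8 * i) 0" if "i \<le> k" for i
    using that
  proof (induction i)
    case 0
    then show ?case by simp
  next
    case (Suc i)
    \<comment> \<open>The first vertex of block \<open>Suc i\<close> is read as offset 8 of block
      \<open>i\<close>, so that the linking edge \<open>(1,8)\<close> applies.\<close>
    have "8 * Suc i = 8 * i + 8"
      by simp
    then have "?R (8 * Suc i) (8 * i + 1)"
      using adj[of 1 8 i] Suc.prems by (simp only:) (simp add: block_edges_def)
    moreover have "?R (8 * i + 1) (8 * i)"
      using block[of 1 i] Suc.prems by linarith
    ultimately show ?case
      using Suc trans by (meson Suc_leD)
  qed
  have reach: "?R u 0" if "u < 8 * Suc k" for u
  proof -
    have "u div 8 \<le> k" "u mod 8 < 8"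
      using that by auto
    then show ?thesis
      using trans[OF block[of "u mod 8" "u div 8"] base[of "u div 8"]] by simp
  qed
  show ?thesis
    unfolding Digraph_Component.connected_def
  proof (rule strongly_connectedI)
    fix u v assume "u \<in> verts (mk_symmetric (with_proj (chain k)))"
      "v \<in> verts (mk_symmetric (with_proj (chain k)))"
    then have "?R u 0" "?R v 0"
      using reach by auto
    then have "?R u v"
      using symmetric_reachable[OF pair_sym_arcs] trans by blast
    then show "reachable (mk_symmetric (with_proj (chain k))) u v"
      by (rule reachable_mk_symmetricI)
  qed (simp add: lessThan_empty_iff)
qed

section \<open>Local structure of a block: weight inequality and neighbourhoods\<close>

lemma block_weight_ge:
  fixes a1 a2 a3 b c l1 l2 l3 :: nat
  assumes "a1 = 0 \<Longrightarrow> a2 + a3 + b + c + l1 \<le> 2"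
    and "a2 = 0 \<Longrightarrow> a1 + a3 + b + c + l2 \<le> 2"
    and "a3 = 0 \<Longrightarrow> a1 + a2 + b + c + l3 \<le> 2"
    and "b = 0 \<Longrightarrow> a1 + a2 + a3 = 2" and "c = 0 \<Longrightarrow> a1 + a2 + a3 = 2"
    and "l1 = 0 \<Longrightarrow> a1 = 2" and "l2 = 0 \<Longrightarrow> a2 = 2" and "l3 = 0 \<Longrightarrow> a3 = 2"
  shows "8 \<le> a1 + a2 + a3 + b + c + l1 + l2 + l3"
proof -
  have "a1 > 0"
    using assms(1,4-6) by (cases "a1 = 0"; cases "b = 0"; cases "c = 0") auto
  moreover have "a2 > 0"
    using assms(2,4,5,7) by (cases "a2 = 0"; cases "b = 0"; cases "c = 0") auto
  moreover have "a3 > 0"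
    using assms(3,4,5,8) by (cases "a3 = 0"; cases "b = 0"; cases "c = 0") auto
  ultimately have "2 \<le> a1 + l1" "2 \<le> a2 + l2" "2 \<le> a3 + l3" "b \<noteq> 0" "c \<noteq> 0"
    using assms(4-8) by force+
  then show ?thesis
    by linarith
qed

text \<open>Offsets range up to 8, so a multiple of 8 is both offset 0 of one block and offset 8 of
  the one before. For \<open>0 < r\<close> and \<open>r < 8\<close> the block is unique, and no arcs
  from other blocks interfere.\<close>

lemma chain_arcs_inner:
  assumes "0 < r" "r < 8"
  shows "(8 * i + r, u) \<in> chain_arcs \<longleftrightarrow>
    (\<exists>c. ((r, c) \<in> block_edges \<or> (c, r) \<in> block_edges) \<and> u = 8 * i + c)"
proof
  assume "(8 * i + r, u) \<in> chain_arcs"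
  then obtain j a b where ab: "(a, b) \<in> block_edges"
    and "8 * i + r = 8 * j + a \<and> u = 8 * j + b \<or> 8 * i + r = 8 * j + b \<and> u = 8 * j + a"
    unfolding chain_arcs_def by blast
  moreover have "i = j \<and> r = c" if "8 * i + r = 8 * j + c" "c \<le> 8" for c
  proof -
    have "i = j"
      using that assms by linarith
    with that show ?thesis
      by simp
  qed
  ultimately show "\<exists>c. ((r, c) \<in> block_edges \<or> (c, r) \<in> block_edges) \<and> u = 8 * i + c"
    using block_edges_less[OF ab] by fastforce
qed (use chain_arcsI in blast)

text \<open>\<open>8 * i\<close> and \<open>8 * i + 1\<close> may have a further neighbour in an
  adjacent block, depending on the position of block \<open>i\<close>. Inclusions suffice for
  triangle vertices, since \<open>block_weight_ge\<close> asks only for upper bounds there; apexes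
  and leaves need exact neighbourhoods.\<close>

lemma neighbours_chain:
  assumes "i \<le> k"
  shows "{8 * i + 1, 8 * i + 2, 8 * i + 3, 8 * i + 4, 8 * i + 5} \<subseteq> neighbours (chain k) (8 * i)"
    and "{8 * i, 8 * i + 2, 8 * i + 3, 8 * i + 4, 8 * i + 6} \<subseteq> neighbours (chain k) (8 * i + 1)"
    and "{8 * i, 8 * i + 1, 8 * i + 3, 8 * i + 4, 8 * i + 7} \<subseteq> neighbours (chain k) (8 * i + 2)"
    and "neighbours (chain k) (8 * i + 3) = {8 * i, 8 * i + 1, 8 * i + 2}"
    and "neighbours (chain k) (8 * i + 4) = {8 * i, 8 * i + 1, 8 * i + 2}"
    and "neighbours (chain k) (8 * i + 5) = {8 * i}"
    and "neighbours (chain k) (8 * i + 6) = {8 * i + 1}"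
    and "neighbours (chain k) (8 * i + 7) = {8 * i + 2}"
proof -
  have nb: "8 * i + c \<in> neighbours (chain k) (8 * i + r)"
    if "(r, c) \<in> block_edges \<or> (c, r) \<in> block_edges" "r < 8" "c < 8" for r c
    using that chain_arcsI[of r c i] chain_arcsI[of c r i] assms by (auto simp: neighbours_def)
  show "{8 * i + 1, 8 * i + 2, 8 * i + 3, 8 * i + 4, 8 * i + 5} \<subseteq> neighbours (chain k) (8 * i)"
    using nb[of 0 1] nb[of 0 2] nb[of 0 3] nb[of 0 4] nb[of 0 5] by (simp add: block_edges_def)
  show "{8 * i, 8 * i + 2, 8 * i + 3, 8 * i + 4, 8 * i + 6} \<subseteq> neighbours (chain k) (8 * i + 1)"
    using nb[of 1 0] nb[of 1 2] nb[of 1 3] nb[of 1 4] nb[of 1 6] by (simp add: block_edges_def)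
  show "{8 * i, 8 * i + 1, 8 * i + 3, 8 * i + 4, 8 * i + 7} \<subseteq> neighbours (chain k) (8 * i + 2)"
    using nb[of 2 0] nb[of 2 1] nb[of 2 3] nb[of 2 4] nb[of 2 7] by (simp add: block_edges_def)
  \<comment> \<open>As the offsets in \<open>C\<close> stay below 8, all these neighbours lie in
    block \<open>i\<close> and survive the truncation at \<open>8 * Suc k\<close>.\<close>
  have inner: "neighbours (chain k) (8 * i + r) = (\<lambda>c. 8 * i + c) ` C"
    if C: "{c. (r, c) \<in> block_edges \<or> (c, r) \<in> block_edges} = C" "C \<subseteq> {..<8}" and r: "0 < r" "r < 8"
    for r C
  proof -
    have "C = {c. (r, c) \<in> block_edges \<or> (c, r) \<in> block_edges} \<inter> {..<8}"
      using C by blast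
    then have "neighbours (chain k) (8 * i + r) \<supseteq> (\<lambda>c. 8 * i + c) ` C"
      using nb r by auto
    moreover have "neighbours (chain k) (8 * i + r) \<subseteq> (\<lambda>c. 8 * i + c) ` C"
      using chain_arcs_inner[OF r] C(1) unfolding neighbours_def parcs_chain by blast
    ultimately show ?thesis
      by blast
  qed
  show "neighbours (chain k) (8 * i + 3) = {8 * i, 8 * i + 1, 8 * i + 2}"
    by (subst inner[of 3 "{0, 1, 2}"]) (auto simp: block_edges_def)
  show "neighbours (chain k) (8 * i + 4) = {8 * i, 8 * i + 1, 8 * i + 2}"
    by (subst inner[of 4 "{0, 1, 2}"]) (auto simp: block_edges_def)
  show "neighbours (chain k) (8 * i + 5) = {8 * i}"
    by (subst inner[of 5 "{0}"]) (auto simp: block_edges_def)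
  show "neighbours (chain k) (8 * i + 6) = {8 * i + 1}"
    by (subst inner[of 6 "{1}"]) (auto simp: block_edges_def)
  show "neighbours (chain k) (8 * i + 7) = {8 * i + 2}"
    by (subst inner[of 7 "{2}"]) (auto simp: block_edges_def)
qed

section \<open>Planarity by straight-line drawings\<close>

lemma planar_straight_line:
  fixes p :: "'a \<Rightarrow> real \<times> real"
  assumes "pair_graph G" and inj: "inj_on p (pverts G)"
    and deg: "\<And>v. v \<in> pverts G \<Longrightarrow> \<exists>u. (v, u) \<in> parcs G"
    and cross: "\<And>u v x y. (u, v) \<in> parcs G \<Longrightarrow> (x, y) \<in> parcs G \<Longrightarrow> {u, v} \<noteq> {x, y} \<Longrightarrow>
      closed_segment (p u) (p v) \<inter> closed_segment (p x) (p y) \<subseteq> p ` ({u, v} \<inter> {x, y})"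
  shows "planar G"
proof -
  interpret pair_graph G by fact
  \<comment> \<open>A drawing assigns curves to unordered edges; the convex hull gives the segment
    without choosing an orientation.\<close>
  define c where "c e = convex hull (p ` e)" for e
  have c: "c {u, v} = closed_segment (p u) (p v)" for u v
    by (simp add: c_def segment_convex_hull)
  have edge: "(\<exists>g. Path_Connected.arc g \<and> pathstart g = p u \<and> pathfinish g = p v \<and> path_image g = c {u, v}) \<and>
      c {u, v} \<inter> p ` pverts G = {p u, p v}" if uv: "(u, v) \<in> parcs G" for u v
  proof
    from uv have "u \<noteq> v" "u \<in> pverts G" "v \<in> pverts G"
      using pair_no_loops in_arcsD1 in_arcsD2 by fastforce+
    then have "p u \<noteq> p v"
      using inj by (auto dest: inj_onD)
    then show "\<exists>g. Path_Connected.arc g \<and> pathstart g = p u \<and> pathfinish g = p v \<and> path_image g = c {u, v}"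
      by (intro exI[of _ "linepath (p u) (p v)"]) (simp add: c arc_linepath)
    have "p w \<in> {p u, p v}" if "w \<in> pverts G" "p w \<in> c {u, v}" for w
    proof -
      \<comment> \<open>An edge at \<open>w\<close> turns a vertex lying on a segment into a meeting
        point of two segments, which \<open>cross\<close> controls.\<close>
      obtain x where x: "(w, x) \<in> parcs G"
        using deg \<open>w \<in> pverts G\<close> by blast
      show ?thesis
      proof (cases "{u, v} = {w, x}")
        case False
        have "p w \<in> closed_segment (p u) (p v) \<inter> closed_segment (p w) (p x)"
          using that by (simp add: c)
        then show ?thesis
          using cross[OF uv x False] by blast
      qed auto
    qed
    moreover have "p u \<in> c {u, v}" "p v \<in> c {u, v}"
      by (simp_all add: c)
    ultimately show "c {u, v} \<inter> p ` pverts G = {p u, p v}"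
      using \<open>u \<in> pverts G\<close> \<open>v \<in> pverts G\<close> by blast
  qed
  have "plane_drawing G p c"
    unfolding plane_drawing_def
  proof (intro conjI)
    show "\<forall>(u, v)\<in>parcs G. \<forall>(x, y)\<in>parcs G.
        {u, v} \<noteq> {x, y} \<longrightarrow> c {u, v} \<inter> c {x, y} \<subseteq> p ` ({u, v} \<inter> {x, y})"
      unfolding c using cross by blast
  qed (use inj edge in blast)+
  then show ?thesis
    unfolding planar_def by blast
qed

text \<open>Apex 3 lies inside the triangle and apex 4 above it. Leaves 5 and 6 hang below the base;
  leaf 7 sits between the edges from 0 to 2 and to 4. Point 8 is point 0 shifted by the block width
  8.\<close>

definition block_point :: "nat \<Rightarrow> real \<times> real" where
  "block_point a = [(0,0), (6,0), (3,3), (3,1), (3,6), (0,-1), (6,-1), (2,3), (8,0)] ! a"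

definition chain_point :: "nat \<Rightarrow> real \<times> real" where
  "chain_point n = (8 * real (n div 8), 0) + block_point (n mod 8)"

lemma block_point_simps [simp]:
  "block_point 0 = (0,0)" "block_point (Suc 0) = (6,0)" "block_point 2 = (3,3)"
  "block_point 3 = (3,1)" "block_point 4 = (3,6)" "block_point 5 = (0,-1)"
  "block_point 6 = (6,-1)" "block_point 7 = (2,3)" "block_point 8 = (8,0)"
  by (simp_all add: block_point_def)

text \<open>The case \<open>a = 8\<close> is consistent because \<open>block_point 8\<close> is
  exactly the translation from one block to the next.\<close>

lemma chain_point_eq:
  assumes "a \<le> 8"
  shows "chain_point (8 * i + a) = (8 * real i, 0) + block_point a"
proof (cases "a = 8")
  case True
  then have "8 * i + a = 8 * Suc i"
    by simp
  then show ?thesis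
    using True by (simp add: chain_point_def del: mult_Suc_right)
qed (use assms in \<open>simp add: chain_point_def\<close>)

lemma inj_chain_point: "inj chain_point"
proof
  fix m n assume eq: "chain_point m = chain_point n"
  have cases8: "a mod 8 \<in> {0,1,2,3,4,5,6,7}" for a :: nat
    by (simp, presburger)
  \<comment> \<open>Abscissas of offsets 0 to 7 lie in the half-open interval from 0 to 8, so the
    abscissa of a point determines its block.\<close>
  have fst: "0 \<le> fst (block_point (a mod 8))" "fst (block_point (a mod 8)) < 8" for a
    using cases8[of a] by auto
  have "8 * real (m div 8) + fst (block_point (m mod 8)) = 8 * real (n div 8) + fst (block_point (n mod 8))"
    using eq unfolding chain_point_def by (metis fst_add fst_conv)
  then have div: "m div 8 = n div 8"
    using fst[of m] fst[of n] by linarith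
  then have "block_point (m mod 8) = block_point (n mod 8)"
    using eq by (simp add: chain_point_def)
  then have "m mod 8 = n mod 8"
    using cases8[of m] cases8[of n] by auto
  with div show "m = n"
    by (metis div_mult_mod_eq)
qed

definition block_segment :: "nat \<times> nat \<Rightarrow> (real \<times> real) set" where
  "block_segment e = closed_segment (block_point (fst e)) (block_point (snd e))"

lemma closed_segment_chain_point:
  assumes "(a, b) \<in> block_edges"
  shows "z \<in> closed_segment (chain_point (8 * i + a)) (chain_point (8 * i + b)) \<longleftrightarrow>
    z - (8 * real i, 0) \<in> block_segment (a, b)"
proof -
  have "a \<le> 8" "b \<le> 8"
    using block_edges_less[OF assms] by auto
  then show ?thesis
    using closed_segment_translation_eq[of "(8 * real i, 0)" "z - (8 * real i, 0)"
        "block_point a" "block_point b"]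
    by (simp add: block_segment_def chain_point_eq)
qed

text \<open>Each edge becomes a linear equation with a range, which reduces questions about
  crossings to linear arithmetic.\<close>

lemma block_segment_cases:
  assumes "(a, b) \<in> block_edges" "(x, y) \<in> block_segment (a, b)"
  shows "a = 0 \<and> b = 1 \<and> y = 0 \<and> 0 \<le> x \<and> x \<le> 6 \<or>
    a = 0 \<and> b = 2 \<and> y = x \<and> 0 \<le> x \<and> x \<le> 3 \<or>
    a = 1 \<and> b = 2 \<and> y = 6 - x \<and> 3 \<le> x \<and> x \<le> 6 \<or>
    a = 0 \<and> b = 3 \<and> x = 3 * y \<and> 0 \<le> y \<and> y \<le> 1 \<or>
    a = 1 \<and> b = 3 \<and> x = 6 - 3 * y \<and> 0 \<le> y \<and> y \<le> 1 \<or>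
    a = 2 \<and> b = 3 \<and> x = 3 \<and> 1 \<le> y \<and> y \<le> 3 \<or>
    a = 0 \<and> b = 4 \<and> y = 2 * x \<and> 0 \<le> x \<and> x \<le> 3 \<or>
    a = 1 \<and> b = 4 \<and> y = 12 - 2 * x \<and> 3 \<le> x \<and> x \<le> 6 \<or>
    a = 2 \<and> b = 4 \<and> x = 3 \<and> 3 \<le> y \<and> y \<le> 6 \<or>
    a = 0 \<and> b = 5 \<and> x = 0 \<and> -1 \<le> y \<and> y \<le> 0 \<or>
    a = 1 \<and> b = 6 \<and> x = 6 \<and> -1 \<le> y \<and> y \<le> 0 \<or>
    a = 2 \<and> b = 7 \<and> y = 3 \<and> 2 \<le> x \<and> x \<le> 3 \<or>
    a = 1 \<and> b = 8 \<and> y = 0 \<and> 6 \<le> x \<and> x \<le> 8"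
proof -
  obtain t where t: "0 \<le> t" "t \<le> 1"
    "x = (1 - t) * fst (block_point a) + t * fst (block_point b)"
    "y = (1 - t) * snd (block_point a) + t * snd (block_point b)"
    using assms(2) by (auto simp: block_segment_def in_segment prod_eq_iff)
  from assms(1) show ?thesis
    unfolding block_edges_def using t
    by (elim insertE emptyE; simp; linarith)
qed

lemma block_segments_meet:
  assumes "(a, b) \<in> block_edges" "(c, d) \<in> block_edges" "(a, b) \<noteq> (c, d)"
    and "z \<in> block_segment (a, b)" "z \<in> block_segment (c, d)"
  shows "z \<in> block_point ` ({a, b} \<inter> {c, d})"
proof -
  obtain x y where z: "z = (x, y)"
    by (cases z)
  show ?thesis
    using block_segment_cases[OF assms(1) assms(4)[unfolded z]]
      block_segment_cases[OF assms(2) assms(5)[unfolded z]] assms(3)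
    \<comment> \<open>All 13 * 13 pairs of edges are checked: each is contradictory or forces a
      common end point.\<close>
    unfolding z by (elim disjE; simp; fail)
qed

text \<open>A block fills a strip of width 8 and touches its right border only at point 8. The left
  border also carries the edge to leaf 5, hence the extra premise \<open>y = 0\<close>
  there.\<close>

lemma block_segment_bounds:
  assumes "(a, b) \<in> block_edges" "(x, y) \<in> block_segment (a, b)"
  shows "0 \<le> x" "x \<le> 8" "x = 8 \<Longrightarrow> b = 8 \<and> y = 0" "x = 0 \<Longrightarrow> y = 0 \<Longrightarrow> a = 0"
  using block_segment_cases[OF assms] by auto

text \<open>Within one block this is \<open>block_segments_meet\<close>. Strips of different blocks
  can meet only if consecutive, on their common border; there the left block has only its point 8,
  which is point 0 of the right one.\<close>

lemma chain_segments_meet: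
  assumes e: "(a, b) \<in> block_edges" "(c, d) \<in> block_edges" and "i \<le> j" "(i, a, b) \<noteq> (j, c, d)"
    and z: "z \<in> closed_segment (chain_point (8 * i + a)) (chain_point (8 * i + b))"
      "z \<in> closed_segment (chain_point (8 * j + c)) (chain_point (8 * j + d))"
  shows "z \<in> chain_point ` ({8 * i + a, 8 * i + b} \<inter> {8 * j + c, 8 * j + d})"
proof -
  obtain x y where xy: "z = (x, y)"
    by (cases z)
  have zi: "(x - 8 * real i, y) \<in> block_segment (a, b)" and zj: "(x - 8 * real j, y) \<in> block_segment (c, d)"
    using z e by (simp_all add: closed_segment_chain_point xy)
  show ?thesis
  proof (cases "i = j")
    case True
    then obtain m where m: "m \<in> {a, b} \<inter> {c, d}" "(x - 8 * real i, y) = block_point m"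
      using block_segments_meet[OF e _ zi] zj assms(4) by blast
    moreover have "m \<le> 8"
      using m(1) block_edges_less[OF e(1)] by auto
    ultimately have "z = chain_point (8 * i + m)"
      by (simp add: chain_point_eq xy flip: m(2))
    then show ?thesis
      using m(1) True by blast
  next
    case False
    have "x - 8 * real i \<le> 8" "0 \<le> x - 8 * real j"
      using block_segment_bounds e zi zj by blast+
    moreover have "real i + 1 \<le> real j"
      using False \<open>i \<le> j\<close> by linarith
    ultimately have j: "real j = real i + 1" and x: "x = 8 * real j"
      by linarith+
    then have "j = Suc i"
      by linarith
    have "b = 8" "y = 0"
      using block_segment_bounds(3)[OF e(1) zi] j x by auto
    moreover have "c = 0"
      using block_segment_bounds(4)[OF e(2) zj] x \<open>y = 0\<close> by auto
    moreover have "z = chain_point (8 * j + 0)"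
      by (subst chain_point_eq) (simp_all add: xy x \<open>y = 0\<close>)
    ultimately show ?thesis
      using \<open>j = Suc i\<close> by auto
  qed
qed

lemma planar_chain: "planar (chain k)"
proof (rule planar_straight_line[OF pair_graph_chain])
  show "inj_on chain_point (pverts (chain k))"
    using inj_chain_point inj_on_subset by blast
  show "\<exists>u. (v, u) \<in> parcs (chain k)" if "v \<in> pverts (chain k)" for v
  proof -
    have i: "v div 8 \<le> k"
      using that by auto
    have "v mod 8 = 0 \<or> v mod 8 = 1 \<or> v mod 8 = 2 \<or> v mod 8 = 3 \<or> v mod 8 = 4 \<or> v mod 8 = 5 \<or> v mod 8 = 6 \<or> v mod 8 = 7"
      by presburger
    moreover have "v = 8 * (v div 8) + v mod 8"
      by simp
    ultimately have "neighbours (chain k) v \<noteq> {}"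
      using neighbours_chain[OF i] by (elim disjE) force+
    then show ?thesis
      by (auto simp: neighbours_def)
  qed
next
  fix u v x y
  assume "(u, v) \<in> parcs (chain k)" "(x, y) \<in> parcs (chain k)" and ne: "{u, v} \<noteq> {x, y}"
  then obtain i a b j c d
    where e: "(a, b) \<in> block_edges" "{u, v} = {8 * i + a, 8 * i + b}"
      and f: "(c, d) \<in> block_edges" "{x, y} = {8 * j + c, 8 * j + d}"
    using chain_arcsE by (metis IntE parcs_chain)
  have ne': "(i, a, b) \<noteq> (j, c, d)"
    using e f ne by auto
  \<comment> \<open>The end points of the two arcs are known only as unordered pairs, so segments
    are rewritten in terms of sets.\<close>
  have seg: "closed_segment (p s) (p t) = convex hull (p ` {s, t})" for p :: "nat \<Rightarrow> real \<times> real" and s t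
    by (simp add: segment_convex_hull)
  show "closed_segment (chain_point u) (chain_point v) \<inter> closed_segment (chain_point x) (chain_point y)
    \<subseteq> chain_point ` ({u, v} \<inter> {x, y})"
  proof (cases "i \<le> j")
    case True
    then show ?thesis
      using chain_segments_meet[OF e(1) f(1) True ne'] unfolding seg e(2) f(2) by blast
  next
    case False
    then show ?thesis
      using chain_segments_meet[OF f(1) e(1) _ ne'[THEN not_sym]] unfolding seg e(2) f(2) by fastforce
  qed
qed

section \<open>The domination number of a chain\<close>

lemma chain_weight_ge:
  assumes "PID_function (chain k) f"
  shows "8 * Suc k \<le> weight (chain k) f"
proof -
  have zero: "(\<Sum>u\<in>neighbours (chain k) v. f u) = 2" if "f v = 0" "v < 8 * Suc k" for v
    using assms that unfolding PID_function_def by auto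
  have fin: "finite (neighbours (chain k) v)" for v
    by (rule finite_subset[of _ "{..<8 * Suc k}"]) (auto simp: neighbours_def)
  have sub: "sum f A \<le> 2" if "f v = 0" "v < 8 * Suc k" "A \<subseteq> neighbours (chain k) v" for v A
    using sum_mono2[OF fin that(3), of f] zero[OF that(1,2)] by simp
  \<comment> \<open>The interval has the shape expected by \<open>sum.nat_group\<close>, which later
    assembles the blocks into the total weight.\<close>
  have "8 \<le> sum f {i * 8..<i * 8 + 8}" if "i \<le> k" for i
  proof -
    note nb = neighbours_chain[OF that]
    have less: "8 * i + a < 8 * Suc k" if "a < 8" for a
      using that \<open>i \<le> k\<close> by simp
    have "8 \<le> f (8 * i) + f (8 * i + 1) + f (8 * i + 2) + f (8 * i + 3) + f (8 * i + 4) +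
        f (8 * i + 5) + f (8 * i + 6) + f (8 * i + 7)"
    proof (rule block_weight_ge)
      show "f (8 * i + 1) + f (8 * i + 2) + f (8 * i + 3) + f (8 * i + 4) + f (8 * i + 5) \<le> 2"
        if "f (8 * i) = 0"
        using sub[OF that _ nb(1)] less[of 0] by simp
      show "f (8 * i) + f (8 * i + 2) + f (8 * i + 3) + f (8 * i + 4) + f (8 * i + 6) \<le> 2"
        if "f (8 * i + 1) = 0"
        using sub[OF that less nb(2)] by simp
      show "f (8 * i) + f (8 * i + 1) + f (8 * i + 3) + f (8 * i + 4) + f (8 * i + 7) \<le> 2"
        if "f (8 * i + 2) = 0"
        using sub[OF that less nb(3)] by simp
      show "f (8 * i) + f (8 * i + 1) + f (8 * i + 2) = 2" if "f (8 * i + 3) = 0"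
        using zero[OF that less] unfolding nb(4) by simp
      show "f (8 * i) + f (8 * i + 1) + f (8 * i + 2) = 2" if "f (8 * i + 4) = 0"
        using zero[OF that less] unfolding nb(5) by simp
      show "f (8 * i) = 2" if "f (8 * i + 5) = 0"
        using zero[OF that less] unfolding nb(6) by simp
      show "f (8 * i + 1) = 2" if "f (8 * i + 6) = 0"
        using zero[OF that less] unfolding nb(7) by simp
      show "f (8 * i + 2) = 2" if "f (8 * i + 7) = 0"
        using zero[OF that less] unfolding nb(8) by simp
    qed
    also have "\<dots> = (\<Sum>a<8. f (8 * i + a))"
    proof -
      have "(\<Sum>a<8. g a) = g 0 + g 1 + g 2 + g 3 + g 4 + g 5 + g 6 + g 7" for g :: "nat \<Rightarrow> nat"
        by (simp add: eval_nat_numeral)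
      from this[of "\<lambda>a. f (8 * i + a)"] show ?thesis
        by simp
    qed
    also have "\<dots> = sum f {i * 8..<i * 8 + 8}"
      using sum.shift_bounds_nat_ivl[of f 0 "8 * i" 8] by (simp add: ac_simps atLeast0LessThan)
    finally show ?thesis .
  qed
  then have "(\<Sum>i<Suc k. 8) \<le> (\<Sum>i<Suc k. sum f {i * 8..<i * 8 + 8})"
    by (intro sum_mono) auto
  then show ?thesis
    by (simp only: sum.nat_group weight_def pverts_chain) (simp add: mult.commute)
qed

lemma perfect_italian_domination_number_chain:
  "perfect_italian_domination_number (chain k) = 8 * Suc k"
  unfolding perfect_italian_domination_number_def
proof (rule Least_equality)
  have "PID_function (chain k) (\<lambda>_. 1) \<and> weight (chain k) (\<lambda>_. 1) = 8 * Suc k"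
    by (simp add: PID_function_def weight_def)
  then show "\<exists>f. PID_function (chain k) f \<and> weight (chain k) f = 8 * Suc k"
    by blast
qed (use chain_weight_ge in auto)

section \<open>Infinitude of the family: chains are told apart by their numbers of vertices\<close>

lemma digraph_iso_card_verts:
  assumes "digraph_iso G H"
  shows "card (verts H) = card (verts G)"
proof -
  obtain f where "pre_digraph.digraph_isomorphism G f" "H = app_iso f G"
    using assms unfolding digraph_iso_def by blast
  then show ?thesis
    by (auto simp: pre_digraph.digraph_isomorphism_def card_image)
qed

theorem theorem26:
  shows "\<exists>G :: nat \<Rightarrow> nat pair_pre_digraph.
           (\<forall>k. pair_graph (G k) \<and> Digraph_Component.connected (with_proj (G k)) \<and> planar (G k) \<and>
                perfect_italian_domination_number (G k) = card (pverts (G k))) \<and>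
           (\<forall>i j. i \<noteq> j \<longrightarrow> \<not> digraph_iso (with_proj (G i)) (with_proj (G j)))"
proof (intro exI[of _ chain] conjI allI impI)
  show "\<not> digraph_iso (with_proj (chain i)) (with_proj (chain j))" if "i \<noteq> j" for i j
    using digraph_iso_card_verts[of "with_proj (chain i)" "with_proj (chain j)"] that by auto
qed (simp_all add: pair_graph_chain connected_chain planar_chain perfect_italian_domination_number_chain)

end
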